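(* Let $q$ be a prime power with $q\equiv1\pmod4$, $n$ an odd prime and $Q=\frac{q^n-1}{q-1}$. Write the product of the distinct primes dividing $Q$ as $k p_1\cdots p_s$ with $p_1,\dots,p_s$ distinct primes (not dividing $k$), and set $\delta=1-\sum_{i=1}^s\frac1{p_i}$. Assume $\delta>0$ and $$q^{\frac n2-1}>\sqrt2\left(\frac{s-1}{\delta}+2\right)W(k).$$ Then $\mathcal{N}_0(q^n-1)>0$.
   Context: For a divisor $m$ of $q^n-1$, $\xi\in\mathbb{F}_{q^n}^*$ is $m$-free if $\xi=\zeta^d$ with $d\mid m$, $\zeta\in\mathbb{F}_{q^n}^*$ implies $d=1$. $\mathcal{N}_0(m)$ is the number of $m$-free $\xi\in\mathbb{F}_{q^n}^*$ with $\mathrm{Tr}(\xi^2)=0$, where $\mathrm{Tr}:\mathbb{F}_{q^n}\to\mathbb{F}_q$ is the trace. $W(m)=2^{\nu(m)}$ with $\nu(m)$ the number of distinct prime divisors of $m$. *)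

theory Defs
  imports Complex_Main "HOL-Library.Cardinality" "HOL-Number_Theory.Number_Theory"
begin

text \<open>
  The field with \<open>q ^ n\<close> elements is a type \<open>'a\<close> of class \<open>finite_field\<close> with
  \<open>CARD('a) = q ^ n\<close>; its subfield with \<open>q\<close> elements consists of the \<open>x\<close> with \<open>x ^ q = x\<close>.
  The relative trace is the sum of the conjugates; its values lie in that subfield but are
  kept in the type \<open>'a\<close>.
\<close>

definition field_Tr :: "nat \<Rightarrow> nat \<Rightarrow> 'a :: finite_field \<Rightarrow> 'a" where
  "field_Tr q n x = (\<Sum>i<n. x ^ (q ^ i))"

definition m_free :: "nat \<Rightarrow> 'a :: finite_field \<Rightarrow> bool" where
  "m_free m \<xi> \<longleftrightarrow> \<xi> \<noteq> 0 \<and> (\<forall>d \<zeta>. d dvd m \<and> \<zeta> \<noteq> 0 \<and> \<xi> = \<zeta> ^ d \<longrightarrow> d = 1)"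

definition N0 :: "'a :: finite_field itself \<Rightarrow> nat \<Rightarrow> nat \<Rightarrow> nat \<Rightarrow> nat" where
  "N0 _ q n m = card {\<xi> :: 'a. m_free m \<xi> \<and> field_Tr q n (\<xi> ^ 2) = 0}"

definition W :: "nat \<Rightarrow> nat" where
  "W m = 2 ^ card (prime_factors m)"

end

theory Submission
  imports Defs "HOL-Library.Product_Plus" "HOL-Computational_Algebra.Polynomial"
begin

text \<open>
  Let \<open>g\<close> generate the multiplicative group of the field with \<open>q ^ n\<close> elements and let \<open>H\<close> be the
  kernel of the trace. The powers of \<open>g ^ Q\<close> are the nonzero elements of the base field and \<open>Q\<close> is
  odd, so it suffices to find an exponent \<open>a\<close> coprime to \<open>Q\<close> with \<open>g ^ a \<in> H\<close>: halving \<open>a\<close> modulo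
  \<open>Q\<close> and shifting it by a multiple of \<open>Q\<close> yields a primitive element whose square is a base field
  multiple of \<open>g ^ a\<close>.

  A nontrivial character of order dividing \<open>Q\<close> is trivial on the base field. Its sum over the
  nonzero elements of \<open>H\<close> has absolute value \<open>(q - 1) q ^ (n/2 - 1)\<close>; instead of Gauss sums this uses
  that the image of \<open>H\<close> in projective space is a Singer difference set, i.e. that \<open>H\<close> and \<open>t H\<close> meet
  in exactly \<open>q ^ (n - 2)\<close> elements for every \<open>t\<close> outside the base field. With this bound, the
  condition of not being divisible by a prime \<open>p\<close> is expanded in \<open>p\<close>-th roots of unity, one prime
  of \<open>k\<close> at a time, and the primes \<open>p\<^sub>1, \<dots>, p\<^sub>s\<close> are treated by the sieve inequality
  \<open>N(k p\<^sub>1 \<dots> p\<^sub>s) \<ge> \<Sum>\<^sub>i N(k p\<^sub>i) - (s - 1) N(k)\<close>.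
\<close>

section \<open>Sieving with complex roots of unity\<close>

text \<open>By Bezout, \<open>a * x = b * y + 1\<close> for some naturals \<open>x\<close>,
  \<open>y\<close>, and comparing powers of \<open>z\<close> leaves \<open>z\<close> itself. Over
  the naturals this needs \<open>a\<close> nonzero; for \<open>a = 0\<close> coprimality forces
  \<open>b = 1\<close>.\<close>

lemma power_coprime_eq_1:
  fixes z :: "'a :: monoid_mult"
  assumes "z ^ a = 1" "z ^ b = 1" "coprime a b"
  shows "z = 1"
proof (cases "a = 0")
  case True
  then show ?thesis using assms by simp
next
  case False
  then obtain x y where "a * x = b * y + gcd a b"
    using bezout_nat by blast
  then have "z ^ (a * x) = z ^ (b * y + 1)"
    using assms(3) by simp
  then show ?thesis
    using assms(1,2) by (simp add: power_mult power_add)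
qed

text \<open>If \<open>p\<close> does not divide \<open>a\<close>, then \<open>z\<close> to
  \<open>z ^ a\<close> permutes the \<open>p\<close>-th roots of unity, so the sum is that of all
  the roots, which vanishes.\<close>

lemma sum_roots_unity_power:
  fixes p a :: nat
  assumes "prime p"
  shows "(\<Sum>z | z ^ p = 1. z ^ a) = (if p dvd a then of_nat p else (0 :: complex))"
proof (cases "p dvd a")
  case True
  then obtain b where "a = p * b" by blast
  then have "(\<Sum>z | z ^ p = 1. z ^ a) = (\<Sum>z :: complex | z ^ p = 1. 1 :: complex)"
    by (intro sum.cong) (auto simp: power_mult)
  then show ?thesis
    using True card_roots_unity_eq[OF prime_gt_0_nat[OF assms]] by simp
next
  case False
  let ?R = "{z :: complex. z ^ p = 1}"
  have fin: "finite ?R"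
    by (rule finite_nth_roots[OF prime_gt_0_nat[OF assms]])
  have cop: "coprime a p"
    using prime_imp_coprime[OF assms False] by (simp only: coprime_commute)
  have "inj_on (\<lambda>z. z ^ a) ?R"
  proof (rule inj_onI)
    fix z w assume zw: "z \<in> ?R" "w \<in> ?R" "z ^ a = w ^ a"
    then have "w \<noteq> 0"
      using prime_gt_0_nat[OF assms] by (auto simp: power_0_left)
    then have "(z / w) ^ a = 1" "(z / w) ^ p = 1"
      using zw by (simp_all add: power_divide)
    then have "z / w = 1"
      by (rule power_coprime_eq_1) (rule cop)
    then show "z = w"
      using \<open>w \<noteq> 0\<close> by simp
  qed
  moreover have "(\<lambda>z. z ^ a) ` ?R \<subseteq> ?R"
  proof safe
    fix z :: complex assume "z ^ p = 1"
    moreover have "(z ^ a) ^ p = (z ^ p) ^ a"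
      by (simp only: power_mult[symmetric] mult.commute)
    ultimately show "(z ^ a) ^ p = 1"
      by simp
  qed
  ultimately have "bij_betw (\<lambda>z. z ^ a) ?R ?R"
    unfolding bij_betw_def using endo_inj_surj[OF fin] by blast
  then have "(\<Sum>z\<in>?R. z ^ a) = \<Sum>?R"
    by (rule sum.reindex_bij_betw[where g = "\<lambda>z. z"])
  also have "\<dots> = 0"
    by (rule sum_roots_unity[OF prime_gt_1_nat[OF assms]])
  finally show ?thesis
    using False by simp
qed

text \<open>All that the sieve knows about the field: \<open>e\<close> plays the discrete logarithm,
  a root of unity \<open>z\<close> stands for the character \<open>z ^ e x\<close>, and every
  nontrivial character of order dividing \<open>Q\<close> has a sum of size at most
  \<open>B\<close>.\<close>

locale bounded_exponential_sums =
  fixes X :: "'b set" and e :: "'b \<Rightarrow> nat" and Q :: nat and B :: real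
  assumes finite_X: "finite X" and B_nonneg: "B \<ge> 0"
    and exponential_sum_bound:
      "\<And>z :: complex. z ^ Q = 1 \<Longrightarrow> z \<noteq> 1 \<Longrightarrow> cmod (\<Sum>x\<in>X. z ^ e x) \<le> B"
begin

text \<open>The twist by \<open>z\<close> is carried along because adding a prime to
  \<open>P\<close> turns a count into sums at other values of \<open>z\<close>; the value at 1 is
  the count.\<close>

definition sieved_sum :: "nat set \<Rightarrow> complex \<Rightarrow> complex" where
  "sieved_sum P z = (\<Sum>x\<in>X. if \<exists>p\<in>P. p dvd e x then 0 else z ^ e x)"

definition sieved_count :: "nat set \<Rightarrow> nat" where
  "sieved_count P = card {x \<in> X. \<not> (\<exists>p\<in>P. p dvd e x)}"

text \<open>For a finite set of primes with product \<open>m\<close> this is Euler's totient of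
  \<open>m\<close> divided by \<open>m\<close>.\<close>

definition density :: "nat set \<Rightarrow> real" where
  "density P = (\<Prod>p\<in>P. 1 - 1 / real p)"

lemma sieved_sum_1: "sieved_sum P 1 = of_real (real (sieved_count P))"
proof -
  have "sieved_sum P 1 = (\<Sum>x\<in>X. if \<not> (\<exists>p\<in>P. p dvd e x) then 1 else 0)"
    unfolding sieved_sum_def by (intro sum.cong) auto
  also have "\<dots> = (\<Sum>x | x \<in> X \<and> \<not> (\<exists>p\<in>P. p dvd e x). 1)"
    by (rule sum.inter_filter[symmetric]) (rule finite_X)
  finally show ?thesis
    by (simp add: sieved_count_def)
qed

lemma density_insert:
  assumes "finite P" "p \<notin> P"
  shows "density (insert p P) = (1 - 1 / real p) * density P"
  using assms by (simp add: density_def)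

lemma density_pos:
  assumes "\<And>p. p \<in> P \<Longrightarrow> prime p"
  shows "density P > 0"
  unfolding density_def
proof (rule prod_pos)
  show "0 < 1 - 1 / real p" if "p \<in> P" for p
    using prime_gt_1_nat[of p] assms[OF that] by simp
qed

text \<open>The indicator of \<open>p dvd e x\<close> is the mean of \<open>w ^ e x\<close> over all
  \<open>p\<close>-th roots of unity \<open>w\<close>. Removing these \<open>x\<close> and splitting
  off \<open>w = 1\<close> gives the density factor and the twisted sums.\<close>

lemma sieved_sum_insert:
  assumes "prime p"
  shows "sieved_sum (insert p P) z =
    of_real (1 - 1 / real p) * sieved_sum P z
      - of_real (1 / real p) * (\<Sum>w\<in>{w. w ^ p = 1} - {1}. sieved_sum P (w * z))"
proof -
  let ?R = "{w :: complex. w ^ p = 1} - {1}"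
  have p: "p > 0" using assms prime_gt_0_nat by blast
  have fin: "finite {w :: complex. w ^ p = 1}"
    using p by blast
  let ?u = "\<lambda>x z. if \<exists>p\<in>P. p dvd e x then 0 else z ^ e x :: complex"
  have pt: "(if \<exists>p\<in>insert p P. p dvd e x then 0 else z ^ e x) =
    of_real (1 - 1 / real p) * ?u x z - of_real (1 / real p) * (\<Sum>w\<in>?R. ?u x (w * z))" for x
  proof (cases "\<exists>p\<in>P. p dvd e x")
    case False
    have "(\<Sum>w\<in>?R. w ^ e x) = (\<Sum>w | w ^ p = 1. w ^ e x) - 1"
      using fin by (subst sum_diff1) auto
    then have "(\<Sum>w\<in>?R. w ^ e x) = (if p dvd e x then of_nat p else 0) - 1"
      using sum_roots_unity_power[OF assms] by simp
    then have "(\<Sum>w\<in>?R. ?u x (w * z)) = ((if p dvd e x then of_nat p else 0) - 1) * z ^ e x"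
      using False by (simp add: power_mult_distrib flip: sum_distrib_right)
    then have "of_real (1 / real p) * (\<Sum>w\<in>?R. ?u x (w * z)) =
        (if p dvd e x then 1 else 0) * z ^ e x - of_real (1 / real p) * z ^ e x"
      using p by (simp add: left_diff_distrib right_diff_distrib)
    then show ?thesis
      using False by (simp add: left_diff_distrib)
  qed auto
  show ?thesis
    unfolding sieved_sum_def pt
    by (subst sum.swap) (simp add: sum_subtractf sum_distrib_left)
qed

text \<open>
  The exponent \<open>r\<close> keeps the order of \<open>z\<close> prime to \<open>P\<close>, so that no product with roots of
  unity of orders in \<open>P\<close> degenerates to the trivial character.
\<close>
lemma sieved_sum_bound:
  assumes "finite P" "\<And>p. p \<in> P \<Longrightarrow> prime p \<and> p dvd Q"
    and "z ^ Q = 1" "z \<noteq> 1" "z ^ r = 1" "\<And>p. p \<in> P \<Longrightarrow> \<not> p dvd r"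
  shows "cmod (sieved_sum P z) \<le> density P * 2 ^ card P * B"
  using assms
proof (induction P arbitrary: z r rule: finite_induct)
  case empty
  then show ?case
    using exponential_sum_bound by (simp add: sieved_sum_def density_def)
next
  case (insert p P)
  let ?R = "{w :: complex. w ^ p = 1} - {1}"
  let ?C = "density P * 2 ^ card P * B"
  have p: "prime p" "p dvd Q" "p > 1"
    using insert.prems(1)[of p] prime_gt_1_nat by auto
  have P: "\<And>p. p \<in> P \<Longrightarrow> prime p \<and> p dvd Q"
    using insert.prems by blast
  have Cz: "cmod (sieved_sum P z) \<le> ?C"
    using insert.prems P by (intro insert.IH[of z r]) auto
  have "cmod (sieved_sum P (w * z)) \<le> ?C" if w: "w \<in> ?R" for w
  proof (rule insert.IH[OF P, where r = "p * r"])
    show "(w * z) ^ Q = 1"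
      using w p(2) insert.prems(2) by (auto simp: power_mult_distrib power_mult elim!: dvdE)
    have wp: "(w * z) ^ (p * r) = (w ^ p) ^ r * (z ^ r) ^ p"
      by (simp only: power_mult_distrib power_mult[symmetric] mult.commute)
    show "(w * z) ^ (p * r) = 1"
      unfolding wp using w insert.prems(4) by simp
    show "w * z \<noteq> 1"
    proof
      assume wz: "w * z = 1"
      have "z ^ p = (w * z) ^ p"
        using w by (simp add: power_mult_distrib)
      then have "z ^ p = 1"
        using wz by simp
      moreover have "coprime p r"
        using insert.prems(5)[of p] p(1) by (simp add: prime_imp_coprime)
      ultimately show False
        using insert.prems(3,4) power_coprime_eq_1 by blast
    qed
    show "\<not> p' dvd p * r" if "p' \<in> P" for p'
      using that P[OF that] insert.prems(5)[of p'] insert.hyps(2) p(1)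
      by (metis insertCI prime_dvd_mult_iff primes_dvd_imp_eq)
  qed
  then have "cmod (\<Sum>w\<in>?R. sieved_sum P (w * z)) \<le> of_nat (card ?R) * ?C"
    by (rule sum_norm_bound)
  also have "card ?R = p - 1"
    using p card_roots_unity_eq[of p] by (subst card_Diff_singleton) auto
  finally have CR: "cmod (\<Sum>w\<in>?R. sieved_sum P (w * z)) \<le> real (p - 1) * ?C" .
  have "cmod (sieved_sum (insert p P) z)
      \<le> cmod (of_real (1 - 1 / real p) * sieved_sum P z)
        + cmod (of_real (1 / real p) * (\<Sum>w\<in>?R. sieved_sum P (w * z)))"
    unfolding sieved_sum_insert[OF p(1)] by (rule norm_triangle_ineq4)
  also have "\<dots> = (1 - 1 / real p) * cmod (sieved_sum P z)
        + (1 / real p) * cmod (\<Sum>w\<in>?R. sieved_sum P (w * z))"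
    using p(3) by (simp only: norm_mult norm_of_real) simp
  also have "\<dots> \<le> (1 - 1 / real p) * ?C + (1 / real p) * (real (p - 1) * ?C)"
    using Cz CR p(3) by (intro add_mono mult_left_mono) auto
  \<comment> \<open>The untwisted term and the \<open>p - 1\<close> twisted ones thus have the same
    bound, which accounts for one factor 2 per prime.\<close>
  also have "(1 / real p) * (real (p - 1) * ?C) = (1 - 1 / real p) * ?C"
    using p(3) by (simp add: field_simps of_nat_diff)
  finally show ?case
    using insert.hyps by (simp add: density_insert algebra_simps)
qed

text \<open>At \<open>z = 1\<close> the main term is the count itself. Each of the
  \<open>p - 1\<close> twists has order \<open>p\<close>, a prime outside \<open>P\<close>, so
  \<open>sieved_sum_bound\<close> applies with \<open>r = p\<close>.\<close>

lemma sieved_count_insert: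
  assumes "finite P" "\<And>p. p \<in> P \<Longrightarrow> prime p \<and> p dvd Q"
    and "prime p" "p dvd Q" "p \<notin> P"
  shows "\<bar>real (sieved_count (insert p P)) - (1 - 1 / real p) * real (sieved_count P)\<bar>
    \<le> (1 - 1 / real p) * (density P * 2 ^ card P * B)"
proof -
  let ?R = "{w :: complex. w ^ p = 1} - {1}"
  let ?C = "density P * 2 ^ card P * B"
  have p1: "p > 1"
    using assms prime_gt_1_nat by auto
  have "cmod (sieved_sum P (w * 1)) \<le> ?C" if w: "w \<in> ?R" for w
  proof (rule sieved_sum_bound[OF assms(1,2), where r = p])
    show "(w * 1) ^ Q = 1"
      using w assms(4) by (auto simp: power_mult elim!: dvdE)
    show "\<not> p' dvd p" if "p' \<in> P" for p'
      using that assms primes_dvd_imp_eq by blast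
  qed (use w in auto)
  then have "cmod (\<Sum>w\<in>?R. sieved_sum P (w * 1)) \<le> of_nat (card ?R) * ?C"
    by (rule sum_norm_bound)
  also have "card ?R = p - 1"
    using p1 card_roots_unity_eq[of p] by (subst card_Diff_singleton) auto
  finally have CR: "cmod (\<Sum>w\<in>?R. sieved_sum P (w * 1)) \<le> real (p - 1) * ?C" .
  have "\<bar>real (sieved_count (insert p P)) - (1 - 1 / real p) * real (sieved_count P)\<bar>
    = cmod (sieved_sum (insert p P) 1 - of_real (1 - 1 / real p) * sieved_sum P 1)"
    unfolding sieved_sum_1 by (simp only: flip: of_real_mult of_real_diff) (simp only: norm_of_real)
  also have "\<dots> = (1 / real p) * cmod (\<Sum>w\<in>?R. sieved_sum P (w * 1))"
    using norm_minus_cancel[of "of_real (1 / real p) * (\<Sum>w\<in>?R. sieved_sum P (w * 1))"]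
    unfolding sieved_sum_insert[OF assms(3)] norm_mult norm_of_real by simp
  also have "\<dots> \<le> (1 / real p) * (real (p - 1) * ?C)"
    using CR by (intro mult_left_mono) auto
  also have "\<dots> = (1 - 1 / real p) * ?C"
    using p1 by (simp add: field_simps of_nat_diff)
  finally show ?thesis .
qed

text \<open>Relative to the density, the errors of the successive insertions are 1, 2, 4, ... times
  \<open>B\<close>, a geometric sum with value \<open>2 ^ card P - 1\<close>.\<close>

lemma sieved_count_bound:
  assumes "finite P" "\<And>p. p \<in> P \<Longrightarrow> prime p \<and> p dvd Q"
  shows "\<bar>real (sieved_count P) - density P * real (card X)\<bar> \<le> density P * (2 ^ card P - 1) * B"
  using assms
proof (induction P rule: finite_induct)
  case empty
  then show ?case
    by (simp add: sieved_count_def density_def)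
next
  case (insert p P)
  let ?c = "1 - 1 / real p"
  have p: "prime p" "p dvd Q" "p > 1"
    using insert.prems[of p] prime_gt_1_nat by auto
  have IH: "\<bar>real (sieved_count P) - density P * real (card X)\<bar>
      \<le> density P * (2 ^ card P - 1) * B"
    using insert by blast
  have "\<bar>real (sieved_count (insert p P)) - density (insert p P) * real (card X)\<bar>
    \<le> \<bar>real (sieved_count (insert p P)) - ?c * real (sieved_count P)\<bar>
      + \<bar>?c * (real (sieved_count P) - density P * real (card X))\<bar>"
    unfolding density_insert[OF insert.hyps] right_diff_distrib mult.assoc by linarith
  also have "\<bar>?c * (real (sieved_count P) - density P * real (card X))\<bar>
    \<le> ?c * (density P * (2 ^ card P - 1) * B)"
    unfolding abs_mult using IH p(3) by (intro mult_mono) auto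
  also have "\<bar>real (sieved_count (insert p P)) - ?c * real (sieved_count P)\<bar>
    \<le> ?c * (density P * 2 ^ card P * B)"
    using insert p by (intro sieved_count_insert) auto
  finally show ?case
    using insert.hyps by (simp add: density_insert algebra_simps)
qed

text \<open>Union bound: whatever survives \<open>P\<close> but not \<open>P'\<close> is removed by
  at least one single prime of \<open>P'\<close>.\<close>

lemma sieved_count_Un:
  assumes "finite P'"
  shows "real (sieved_count (P \<union> P')) \<ge>
    real (sieved_count P) - (\<Sum>p\<in>P'. real (sieved_count P) - real (sieved_count (insert p P)))"
proof -
  have "{x \<in> X. \<not> (\<exists>p\<in>P. p dvd e x)} \<subseteq> {x \<in> X. \<not> (\<exists>p\<in>P \<union> P'. p dvd e x)}
     \<union> (\<Union>p\<in>P'. {x \<in> X. \<not> (\<exists>p\<in>P. p dvd e x)} - {x \<in> X. \<not> (\<exists>p\<in>insert p P. p dvd e x)})"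
    by auto
  then have "sieved_count P \<le> card ({x \<in> X. \<not> (\<exists>p\<in>P \<union> P'. p dvd e x)}
     \<union> (\<Union>p\<in>P'. {x \<in> X. \<not> (\<exists>p\<in>P. p dvd e x)} - {x \<in> X. \<not> (\<exists>p\<in>insert p P. p dvd e x)}))"
    unfolding sieved_count_def using finite_X assms by (intro card_mono) auto
  also have "\<dots> \<le> sieved_count (P \<union> P') +
     card (\<Union>p\<in>P'. {x \<in> X. \<not> (\<exists>p\<in>P. p dvd e x)} - {x \<in> X. \<not> (\<exists>p\<in>insert p P. p dvd e x)})"
    unfolding sieved_count_def by (rule card_Un_le)
  also have "\<dots> \<le> sieved_count (P \<union> P') + (\<Sum>p\<in>P'.
     card ({x \<in> X. \<not> (\<exists>p\<in>P. p dvd e x)} - {x \<in> X. \<not> (\<exists>p\<in>insert p P. p dvd e x)}))"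
    by (intro add_left_mono card_UN_le assms)
  also have "\<dots> = sieved_count (P \<union> P') + (\<Sum>p\<in>P'. sieved_count P - sieved_count (insert p P))"
    unfolding sieved_count_def using finite_X
    by (intro arg_cong2[where f = "(+)"] sum.cong card_Diff_subset refl) auto
  finally have "sieved_count P \<le>
    sieved_count (P \<union> P') + (\<Sum>p\<in>P'. sieved_count P - sieved_count (insert p P))" .
  then have "real (sieved_count P) \<le> real (sieved_count (P \<union> P')
      + (\<Sum>p\<in>P'. sieved_count P - sieved_count (insert p P)))"
    by (rule of_nat_mono)
  moreover have "sieved_count (insert p P) \<le> sieved_count P" for p
    unfolding sieved_count_def using finite_X by (intro card_mono) auto
  ultimately show ?thesis
    by (simp add: of_nat_diff)
qed

text \<open>By \<open>sieved_count_insert\<close>, a prime \<open>p\<close> of \<open>P'\<close>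
  removes at most a fraction \<open>1 / p\<close> of the survivors of \<open>P\<close>, up to an
  error. What remains is the fraction \<open>\<delta>\<close>, and \<open>sieved_count_bound\<close>
  supplies the survivors of \<open>P\<close>. Dividing by \<open>\<delta> * density P\<close>
  produces the condition \<open>large\<close>.\<close>

proposition prime_sieve:
  assumes "finite P" "finite P'" "P \<inter> P' = {}" "\<And>p. p \<in> P \<union> P' \<Longrightarrow> prime p \<and> p dvd Q"
    and \<delta>: "\<delta> = 1 - (\<Sum>p\<in>P'. 1 / real p)" "\<delta> > 0"
    and large: "real (card X) > B * (((real (card P') - 1) / \<delta> + 2) * 2 ^ card P - 1)"
  shows "sieved_count (P \<union> P') > 0"
proof -
  let ?N = "\<lambda>P. real (sieved_count P)"
  define C where "C = density P * 2 ^ card P * B"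
  have dens: "density P > 0"
    using assms by (intro density_pos) auto
  have sum_c: "(\<Sum>p\<in>P'. 1 - 1 / real p) = real (card P') - 1 + \<delta>"
    by (simp add: sum_subtractf \<delta>)
  have "\<delta> * ?N P - (real (card P') - 1 + \<delta>) * C
      = ?N P - (\<Sum>p\<in>P'. 1 / real p) * ?N P - (\<Sum>p\<in>P'. 1 - 1 / real p) * C"
    unfolding sum_c by (simp add: \<delta> algebra_simps)
  also have "\<dots> = ?N P - (\<Sum>p\<in>P'. 1 / real p * ?N P + (1 - 1 / real p) * C)"
    unfolding sum.distrib by (simp only: sum_distrib_right diff_diff_eq)
  also have "\<dots> \<le> ?N P - (\<Sum>p\<in>P'. ?N P - ?N (insert p P))"
  proof (intro diff_left_mono sum_mono)
    fix p assume "p \<in> P'"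
    then have "\<bar>?N (insert p P) - (1 - 1 / real p) * ?N P\<bar> \<le> (1 - 1 / real p) * C"
      unfolding C_def using assms by (intro sieved_count_insert) auto
    then show "?N P - ?N (insert p P) \<le> 1 / real p * ?N P + (1 - 1 / real p) * C"
      by (simp add: algebra_simps abs_le_iff)
  qed
  also have "\<dots> \<le> ?N (P \<union> P')"
    using assms by (intro sieved_count_Un)
  finally have main: "\<delta> * ?N P - (real (card P') - 1 + \<delta>) * C \<le> ?N (P \<union> P')" .
  have "\<bar>?N P - density P * real (card X)\<bar> \<le> density P * (2 ^ card P - 1) * B"
    using assms by (intro sieved_count_bound) auto
  then have "density P * (real (card X) - (2 ^ card P - 1) * B) \<le> ?N P"
    by (simp add: algebra_simps abs_le_iff)
  then have "\<delta> * (density P * (real (card X) - (2 ^ card P - 1) * B)) \<le> \<delta> * ?N P"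
    using \<delta>(2) by simp
  moreover have "\<delta> * (density P * (real (card X) - (2 ^ card P - 1) * B))
      - (real (card P') - 1 + \<delta>) * C
    = \<delta> * density P * (real (card X) - B * (((real (card P') - 1) / \<delta> + 2) * 2 ^ card P - 1))"
  proof -
    \<comment> \<open>Naming the quotient makes the identity polynomial in \<open>\<delta>\<close>
      and \<open>b\<close>.\<close>
    define b where "b = (real (card P') - 1) / \<delta>"
    have "real (card P') - 1 = \<delta> * b"
      using \<delta>(2) by (simp add: b_def)
    then show ?thesis
      unfolding C_def b_def[symmetric] by (simp only: algebra_simps)
  qed
  moreover have "\<dots> > 0"
    using \<delta>(2) dens large by simp
  ultimately show ?thesis
    using main by linarith
qed

end

section \<open>The trace hyperplane of a finite field\<close>

text \<open>The type class operations are packed into a ring record, to which the theorem on cyclic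
  multiplicative groups of finite fields applies.\<close>

lemma finite_field_generator:
  obtains g :: "'a :: finite_field" where "g \<noteq> 0" "\<And>x. x \<noteq> 0 \<Longrightarrow> \<exists>a. x = g ^ a"
proof -
  define R :: "'a ring" where
    "R = \<lparr>carrier = UNIV, monoid.mult = (*), one = 1, ring.zero = 0, add = (+)\<rparr>"
  have "\<exists>y. x + y = 0" for x :: 'a
    using add.right_inverse by blast
  moreover have "\<exists>y. x * y = 1" if "x \<noteq> 0" for x :: 'a
    using that by (intro exI[of _ "inverse x"]) simp
  ultimately have "field R"
    unfolding R_def by unfold_locales (auto simp: algebra_simps Units_def)
  then interpret field R .
  have pow: "x [^]\<^bsub>R\<^esub> (i :: nat) = x ^ i" for x i
  proof (induction i)
    case (Suc i)
    have "x [^]\<^bsub>R\<^esub> Suc i = x [^]\<^bsub>R\<^esub> i * x"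
      by (simp add: nat_pow_Suc R_def)
    then show ?case
      by (simp only: Suc power_Suc2)
  qed (simp add: nat_pow_0 R_def)
  have "\<exists>a\<in>carrier (mult_of R). carrier (mult_of R) = {a [^]\<^bsub>R\<^esub> i | i :: nat. i \<in> UNIV}"
    by (rule finite_field_mult_group_has_gen) (simp add: R_def)
  moreover have "carrier (mult_of R) = UNIV - {0}"
    by (simp add: R_def)
  ultimately have "\<exists>g\<in>UNIV - {0 :: 'a}. UNIV - {0} = {g ^ i | i. i \<in> UNIV}"
    by (simp only: pow)
  then obtain g :: 'a where g: "g \<in> UNIV - {0}" "UNIV - {0} = {g ^ i | i. i \<in> UNIV}"
    by (elim bexE)
  show ?thesis
  proof (rule that[of g])
    fix x :: 'a assume "x \<noteq> 0"
    then have "x \<in> {g ^ i | i. i \<in> UNIV}"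
      unfolding g(2)[symmetric] by simp
    then show "\<exists>a. x = g ^ a" by blast
  qed (use g(1) in simp)
qed

text \<open>Every nonempty fibre is a translate of the kernel.\<close>

lemma card_kernel_times_range:
  fixes \<phi> :: "'a :: {finite, ab_group_add} \<Rightarrow> 'b :: ab_group_add"
  assumes add: "\<And>x y. \<phi> (x + y) = \<phi> x + \<phi> y"
  shows "CARD('a) = card {x. \<phi> x = 0} * card (range \<phi>)"
proof -
  have fibre: "card {x. \<phi> x = y} = card {x. \<phi> x = 0}" if "y \<in> range \<phi>" for y
  proof -
    from that obtain a where a: "y = \<phi> a" by blast
    have "\<phi> (x - a) = \<phi> x - \<phi> a" for x
      using add[of "x - a" a] by (simp add: algebra_simps)
    then have "bij_betw (\<lambda>x. x + a) {x. \<phi> x = 0} {x. \<phi> x = y}"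
      by (intro bij_betw_byWitness[where f' = "\<lambda>x. x - a"]) (auto simp: a add)
    then show ?thesis
      by (simp add: bij_betw_same_card)
  qed
  have "CARD('a) = (\<Sum>x\<in>(UNIV :: 'a set). 1)"
    by simp
  also have "\<dots> = (\<Sum>y\<in>range \<phi>. \<Sum>x | x \<in> UNIV \<and> \<phi> x = y. 1)"
    by (rule sum.group[symmetric]) auto
  also have "\<dots> = (\<Sum>y\<in>range \<phi>. card {x. \<phi> x = 0})"
    by (intro sum.cong) (simp_all add: fibre)
  finally show ?thesis
    by simp
qed

locale finite_field_extension =
  fixes q n :: nat and g :: "'a :: finite_field"
  assumes primepow_q: "primepow q" and n_ge_2: "n \<ge> 2" and card_field: "CARD('a) = q ^ n"
    and g_nonzero: "g \<noteq> 0" and generator: "\<And>x. x \<noteq> 0 \<Longrightarrow> \<exists>a. x = g ^ a"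
begin

abbreviation Tr :: "'a \<Rightarrow> 'a" where "Tr \<equiv> field_Tr q n"

abbreviation base_field :: "'a set" where "base_field \<equiv> {c. c ^ q = c}"

lemma q_gt_1: "q > 1"
  using primepow_gt_Suc_0[OF primepow_q] by simp

lemma q_power_step: "q ^ n = q ^ (n - 1) * q" "q ^ (n - 1) = q ^ (n - 2) * q"
proof -
  obtain m where "n = m + 2"
    using n_ge_2 le_Suc_ex by (metis add.commute)
  then show "q ^ n = q ^ (n - 1) * q" "q ^ (n - 1) = q ^ (n - 2) * q"
    by simp_all
qed

text \<open>The characteristic is a prime dividing the field size, hence the prime below
  \<open>q\<close>, and \<open>q ^ i\<close> is a power of it.\<close>

lemma power_q_add: "(x + y :: 'a) ^ (q ^ i) = x ^ (q ^ i) + y ^ (q ^ i)"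
proof -
  obtain p k where p: "prime p" "k > 0" "q = p ^ k"
    using primepow_q by (auto simp: primepow_def)
  have "CHAR('a) dvd p ^ (k * n)"
    using CHAR_dvd_CARD[where 'a = 'a] unfolding card_field p(3) power_mult .
  then have "CHAR('a) dvd p"
    by (rule prime_dvd_power[OF CHAR_prime])
  then have "CHAR('a) = p"
    by (rule primes_dvd_imp_eq[OF CHAR_prime p(1)])
  then have "q ^ i = CHAR('a) ^ (k * i)"
    unfolding p(3) power_mult by simp
  then show ?thesis
    by (rule freshmans_dream'[OF CHAR_prime])
qed

lemma Tr_add: "Tr (x + y) = Tr x + Tr y"
  by (simp add: field_Tr_def power_q_add sum.distrib)

lemma Tr_0: "Tr 0 = 0"
  using Tr_add[of 0 0] by (simp only: add_0_right add_cancel_right_right)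

lemma base_field_power: "c ^ (q ^ i) = c" if "c \<in> base_field"
  using that by (induction i) (simp_all add: power_mult)

lemma Tr_scale: "Tr (c * x) = c * Tr x" if "c \<in> base_field"
  using that by (simp add: field_Tr_def power_mult_distrib base_field_power sum_distrib_left)

text \<open>Raising to the power \<open>q\<close> shifts the conjugates by one place, and
  \<open>x ^ (q ^ n) = x\<close> closes the cycle.\<close>

lemma Tr_in_base_field: "Tr x \<in> base_field"
proof -
  have sum_q: "(\<Sum>i\<in>A. f i) ^ q = (\<Sum>i\<in>A. f i ^ q)" for f :: "nat \<Rightarrow> 'a" and A
    using q_gt_1 power_q_add[where i = 1]
    by (induction A rule: infinite_finite_induct) (auto simp: power_0_left)
  have "Tr x ^ q = (\<Sum>i<n. x ^ (q ^ Suc i))"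
    unfolding field_Tr_def sum_q power_Suc2 power_mult ..
  also have "\<dots> = (\<Sum>i<n. x ^ (q ^ i)) - x ^ (q ^ 0) + x ^ (q ^ n)"
    using sum.lessThan_Suc_shift[of "\<lambda>i. x ^ (q ^ i)" n] by (simp add: algebra_simps)
  also have "x ^ (q ^ n) = x"
    using finite_field_power_card_eq_same[of x] by (simp add: card_field)
  finally show ?thesis
    by (simp add: field_Tr_def)
qed

lemma card_base_field_le: "card base_field \<le> q"
proof -
  let ?f = "monom 1 q - monom 1 1 :: 'a poly"
  have c: "coeff ?f q = 1"
    using q_gt_1 by simp
  then have "?f \<noteq> 0"
    by (metis coeff_0 zero_neq_one)
  then have "card {x. poly ?f x = 0} \<le> degree ?f"
    by (rule card_poly_roots_bound)
  also have "{x. poly ?f x = 0} = base_field"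
    by (simp add: poly_monom)
  also have "degree ?f \<le> q"
    using q_gt_1 by (intro degree_diff_le) (auto simp: degree_monom_le intro: order.trans[OF degree_monom_le])
  finally show ?thesis .
qed

text \<open>Degrees of polynomials bound the kernel by \<open>q ^ (n - 1)\<close> and the base field
  by \<open>q\<close>. The kernel times the range has size \<open>q ^ n\<close>, so both bounds are
  attained.\<close>

lemma card_Tr_kernel: "card {x. Tr x = 0} = q ^ (n - 1)"
  and card_base_field: "card base_field = q"
proof -
  let ?f = "\<Sum>i<n. monom 1 (q ^ i) :: 'a poly"
  \<comment> \<open>Only \<open>i = 0\<close> contributes to the linear coefficient, so the trace
    polynomial is not zero.\<close>
  have "coeff ?f 1 = (\<Sum>i<n. if i = 0 then 1 else 0)"
    unfolding coeff_sum coeff_monom using q_gt_1 by (intro sum.cong) auto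
  then have "coeff ?f 1 = 1"
    using n_ge_2 by simp
  then have "?f \<noteq> 0"
    by (metis coeff_0 zero_neq_one)
  then have "card {x. poly ?f x = 0} \<le> degree ?f"
    by (rule card_poly_roots_bound)
  also have "{x. poly ?f x = 0} = {x. Tr x = 0}"
    by (simp add: poly_sum poly_monom field_Tr_def)
  also have "degree ?f \<le> q ^ (n - 1)"
  proof (rule degree_sum_le)
    fix i assume "i \<in> {..<n}"
    then have "q ^ i \<le> q ^ (n - 1)"
      using q_gt_1 by (intro power_increasing) auto
    then show "degree (monom 1 (q ^ i) :: 'a poly) \<le> q ^ (n - 1)"
      using degree_monom_le order.trans by blast
  qed simp
  finally have le: "card {x. Tr x = 0} \<le> q ^ (n - 1)" .
  have "card (range Tr) \<le> card base_field"
    using Tr_in_base_field by (intro card_mono) auto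
  then have "q ^ n \<le> card {x. Tr x = 0} * card base_field"
    using card_kernel_times_range[of Tr] Tr_add card_field by simp
  then have prod: "q ^ (n - 1) * q \<le> card {x. Tr x = 0} * card base_field"
    by (simp only: q_power_step(1))
  also have "\<dots> \<le> card {x. Tr x = 0} * q"
    using card_base_field_le by simp
  finally show *: "card {x. Tr x = 0} = q ^ (n - 1)"
    using le q_gt_1 by simp
  show "card base_field = q"
    using prod card_base_field_le q_gt_1 by (simp add: *)
qed

section \<open>Intersections of the trace hyperplane with its multiples\<close>

lemma card_Tr_kernel_scaled: "card {y. Tr (x * y) = 0} = q ^ (n - 1)" if "x \<noteq> 0"
proof -
  have "bij_betw (\<lambda>y. x * y) {y. Tr (x * y) = 0} {y. Tr y = 0}"
    by (rule bij_betw_byWitness[where f' = "\<lambda>y. y / x"]) (use that in auto)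
  then show ?thesis
    by (simp add: bij_betw_same_card card_Tr_kernel)
qed

definition overlap :: "'a \<Rightarrow> nat" where
  "overlap t = card {y. Tr y = 0 \<and> Tr (t * y) = 0}"

lemma overlap_base_field: "overlap t = q ^ (n - 1)" if "t \<in> base_field"
proof -
  have "{y. Tr y = 0 \<and> Tr (t * y) = 0} = {y. Tr y = 0}"
    using Tr_scale[OF that] by auto
  then show ?thesis
    by (simp add: overlap_def card_Tr_kernel)
qed

text \<open>Two linear conditions with values in the base field cut the size by a factor of at most
  \<open>q * q\<close>.\<close>

lemma overlap_ge: "overlap t \<ge> q ^ (n - 2)"
proof -
  let ?\<phi> = "\<lambda>y. (Tr y, Tr (t * y))"
  have "CARD('a) = card {y. ?\<phi> y = 0} * card (range ?\<phi>)"
    by (rule card_kernel_times_range) (simp add: Tr_add distrib_left)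
  moreover have "card (range ?\<phi>) \<le> card (base_field \<times> base_field)"
    using Tr_in_base_field by (intro card_mono) auto
  moreover have "{y. ?\<phi> y = 0} = {y. Tr y = 0 \<and> Tr (t * y) = 0}"
    by (simp add: zero_prod_def)
  ultimately have "q ^ n \<le> overlap t * (q * q)"
    by (simp add: overlap_def card_field card_cartesian_product card_base_field)
  moreover have "q ^ n = q ^ (n - 2) * (q * q)"
    by (simp only: q_power_step mult.assoc)
  ultimately show ?thesis
    using q_gt_1 by simp
qed

text \<open>
  Double counting gives the exact value of the total overlap, which leaves no room for strict
  inequality in the lower bound.
\<close>
lemma overlap_outside_base_field: "overlap t = q ^ (n - 2)" if "t \<notin> base_field"
proof -
  let ?H = "{y. Tr y = 0}"
  have "(\<Sum>t\<in>UNIV. overlap t) = (\<Sum>t\<in>UNIV. \<Sum>y\<in>?H. if Tr (t * y) = 0 then 1 else 0)"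
    unfolding overlap_def by (intro sum.cong refl) (simp add: sum.If_cases Int_def conj_commute)
  also have "\<dots> = (\<Sum>y\<in>?H. \<Sum>t\<in>UNIV. if Tr (t * y) = 0 then 1 else 0)"
    by (rule sum.swap)
  also have "\<dots> = (\<Sum>y\<in>?H. card {t. Tr (t * y) = 0})"
    by (simp add: sum.If_cases)
  also have "\<dots> = card {t. Tr (t * 0) = 0} + (\<Sum>y\<in>?H - {0}. card {t. Tr (t * y) = 0})"
    by (rule sum.remove) (simp_all add: Tr_0)
  also have "card {t. Tr (t * 0) = 0} = q ^ n"
    by (simp add: Tr_0 card_field)
  also have "(\<Sum>y\<in>?H - {0}. card {t. Tr (t * y) = 0}) = (\<Sum>y\<in>?H - {0}. q ^ (n - 1))"
    by (intro sum.cong refl) (use card_Tr_kernel_scaled in \<open>simp add: mult.commute\<close>)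
  also have "\<dots> = (q ^ (n - 1) - 1) * q ^ (n - 1)"
    using Tr_0 by (simp add: card_Tr_kernel)
  finally have total: "(\<Sum>t\<in>UNIV. overlap t) = q ^ n + (q ^ (n - 1) - 1) * q ^ (n - 1)" .
  have "(\<Sum>t\<in>UNIV. overlap t) = (\<Sum>t\<in>UNIV - base_field. overlap t) + (\<Sum>t\<in>base_field. overlap t)"
    by (rule sum.subset_diff) auto
  also have "(\<Sum>t\<in>base_field. overlap t) = (\<Sum>t\<in>base_field. q ^ (n - 1))"
    using overlap_base_field by (intro sum.cong refl) blast
  \<comment> \<open>The base field values of \<open>t\<close> contribute exactly what
    \<open>y = 0\<close> contributed to the total, so the two cancel.\<close>
  also have "\<dots> = q ^ n"
    by (simp add: card_base_field q_power_step(1))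
  finally have "(\<Sum>t\<in>UNIV - base_field. overlap t) = (q ^ (n - 1) - 1) * q ^ (n - 1)"
    using total by simp
  also have "\<dots> = (q ^ n - q) * q ^ (n - 2)"
    unfolding q_power_step by (simp add: algebra_simps)
  also have "\<dots> = (\<Sum>t\<in>UNIV - base_field. q ^ (n - 2))"
    by (simp add: card_Diff_subset card_base_field card_field)
  finally have "(\<Sum>t\<in>UNIV - base_field. q ^ (n - 2)) = (\<Sum>t\<in>UNIV - base_field. overlap t)" ..
  then show ?thesis
    by (rule sum_mono_inv[symmetric]) (use that overlap_ge in auto)
qed

subsection \<open>Multiplicative characters\<close>

lemma power_g_eq_1: "g ^ (q ^ n - 1) = 1"
proof -
  have "g ^ (q ^ n) = g ^ (q ^ n - 1) * g"
    using q_gt_1 power_Suc2[of g "q ^ n - 1"] by simp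
  then show ?thesis
    using finite_field_power_card_eq_same[of g] g_nonzero by (simp add: card_field)
qed

lemma power_g_mod: "g ^ (a mod (q ^ n - 1)) = g ^ a"
proof -
  have "g ^ a = g ^ ((q ^ n - 1) * (a div (q ^ n - 1)) + a mod (q ^ n - 1))"
    by simp
  also have "\<dots> = g ^ (a mod (q ^ n - 1))"
    unfolding power_add power_mult power_g_eq_1 by simp
  finally show ?thesis ..
qed

lemma order_pos: "q ^ n - 1 > 0"
  using q_gt_1 n_ge_2 one_less_power[of q n] by simp

text \<open>The powers with exponent below \<open>q ^ n - 1\<close> cover all
  \<open>q ^ n - 1\<close> nonzero elements, so they are distinct.\<close>

lemma power_g_eq_iff: "g ^ a = g ^ b \<longleftrightarrow> [a = b] (mod (q ^ n - 1))"
proof -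
  have "(\<lambda>a. g ^ a) ` {..<q ^ n - 1} = UNIV - {0}"
  proof (intro equalityI subsetI)
    fix x :: 'a assume "x \<in> UNIV - {0}"
    then obtain a where "x = g ^ a"
      using generator by blast
    then show "x \<in> (\<lambda>a. g ^ a) ` {..<q ^ n - 1}"
      using order_pos power_g_mod by (intro image_eqI[of _ _ "a mod (q ^ n - 1)"]) auto
  qed (use g_nonzero in auto)
  then have "card ((\<lambda>a. g ^ a) ` {..<q ^ n - 1}) = card {..<q ^ n - 1}"
    by (simp add: card_field)
  then have "inj_on (\<lambda>a. g ^ a) {..<q ^ n - 1}"
    by (rule eq_card_imp_inj_on[rotated]) simp
  then have "g ^ (a mod (q ^ n - 1)) = g ^ (b mod (q ^ n - 1)) \<longleftrightarrow> [a = b] (mod (q ^ n - 1))"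
    using order_pos unfolding inj_on_def cong_def by auto
  then show ?thesis
    by (simp only: power_g_mod)
qed

text \<open>A discrete logarithm, determined only modulo \<open>q ^ n - 1\<close>. For
  \<open>z ^ (q ^ n - 1) = 1\<close> the map \<open>x\<close> to \<open>z ^ ind x\<close> is the
  multiplicative character sending \<open>g\<close> to \<open>z\<close>, whichever logarithm is
  chosen.\<close>

definition ind :: "'a \<Rightarrow> nat" where
  "ind x = (SOME a. x = g ^ a)"

lemma power_ind: "g ^ ind x = x" if "x \<noteq> 0"
  using someI_ex[OF generator[OF that]] by (simp add: ind_def)

lemma root_of_unity_power_cong:
  fixes z :: complex
  assumes "z ^ (q ^ n - 1) = 1" "[a = b] (mod (q ^ n - 1))"
  shows "z ^ a = z ^ b"
proof -
  have "z ^ (a mod (q ^ n - 1)) = z ^ a" for a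
  proof -
    have "z ^ a = z ^ ((q ^ n - 1) * (a div (q ^ n - 1)) + a mod (q ^ n - 1))"
      by simp
    also have "\<dots> = z ^ (a mod (q ^ n - 1))"
      unfolding power_add power_mult assms(1) by simp
    finally show ?thesis ..
  qed
  then show ?thesis
    using assms(2) by (metis cong_def)
qed

lemma power_ind_mult:
  fixes z :: complex
  assumes "z ^ (q ^ n - 1) = 1" "x \<noteq> 0" "y \<noteq> 0"
  shows "z ^ ind (x * y) = z ^ ind x * z ^ ind y"
proof -
  have "g ^ ind (x * y) = g ^ (ind x + ind y)"
    using assms by (simp add: power_add power_ind)
  then have "[ind (x * y) = ind x + ind y] (mod (q ^ n - 1))"
    by (simp only: power_g_eq_iff)
  then show ?thesis
    using root_of_unity_power_cong[OF assms(1)] by (simp flip: power_add)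
qed

text \<open>Substituting \<open>g * x\<close> for \<open>x\<close> multiplies the sum by
  \<open>z\<close>, which differs from 1.\<close>

lemma sum_power_ind:
  fixes z :: complex
  assumes "z ^ (q ^ n - 1) = 1" "z \<noteq> 1"
  shows "(\<Sum>x\<in>UNIV - {0}. z ^ ind x) = 0"
proof -
  have "[ind g = 1] (mod (q ^ n - 1))"
    unfolding power_g_eq_iff[symmetric] using power_ind[OF g_nonzero] by simp
  then have z: "z ^ ind g = z"
    using root_of_unity_power_cong[OF assms(1)] by fastforce
  have "(\<Sum>x\<in>UNIV - {0}. z ^ ind x) = (\<Sum>x\<in>UNIV - {0}. z ^ ind (g * x))"
    by (rule sum.reindex_bij_witness[of _ "\<lambda>x. g * x" "\<lambda>x. x / g"]) (use g_nonzero in auto)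
  also have "\<dots> = (\<Sum>x\<in>UNIV - {0}. z * z ^ ind x)"
    by (intro sum.cong refl) (simp add: power_ind_mult[OF assms(1) g_nonzero] z)
  also have "\<dots> = z * (\<Sum>x\<in>UNIV - {0}. z ^ ind x)"
    by (simp add: sum_distrib_left)
  finally have "(1 - z) * (\<Sum>x\<in>UNIV - {0}. z ^ ind x) = 0"
    by (simp add: left_diff_distrib)
  then show ?thesis
    using assms(2) by simp
qed

definition Q :: nat where "Q = (q ^ n - 1) div (q - 1)"

lemma Q_mult: "Q * (q - 1) = q ^ n - 1"
proof -
  have "int (q - 1) dvd int (q ^ n - 1)"
    using q_gt_1 power_diff_1_eq[of "int q" n] by (simp add: of_nat_diff)
  then have "q - 1 dvd q ^ n - 1"
    by (simp only: of_nat_dvd_iff)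
  then show ?thesis
    by (simp add: Q_def)
qed

text \<open>From \<open>c ^ (q - 1) = 1\<close> it follows that \<open>Q * (q - 1)\<close> divides
  \<open>ind c * (q - 1)\<close>. Hence characters of order dividing \<open>Q\<close> are trivial on
  the base field.\<close>

lemma Q_dvd_ind: "Q dvd ind c" if "c \<in> base_field" "c \<noteq> 0"
proof -
  have "c ^ (q - 1) * c = 1 * c"
    using that(1) q_gt_1 power_Suc2[of c "q - 1"] by simp
  then have "g ^ (ind c * (q - 1)) = g ^ 0"
    using that(2) by (simp add: power_mult power_ind)
  then have "[ind c * (q - 1) = 0] (mod (q ^ n - 1))"
    by (simp only: power_g_eq_iff)
  then have "Q * (q - 1) dvd ind c * (q - 1)"
    unfolding Q_mult by (simp only: cong_0_iff)
  then show ?thesis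
    using q_gt_1 dvd_times_right_cancel_iff[of "q - 1" Q "ind c"] by simp
qed

lemma power_g_Q_in_base_field: "g ^ (Q * b) \<in> base_field"
proof -
  have "q = (q - 1) + 1"
    using q_gt_1 by simp
  then have "(g ^ (Q * b)) ^ q = (g ^ (Q * b)) ^ (q - 1) * g ^ (Q * b)"
    by (metis power_add power_one_right)
  also have "(g ^ (Q * b)) ^ (q - 1) = (g ^ (Q * (q - 1))) ^ b"
    by (simp only: power_mult[symmetric] mult_ac)
  also have "\<dots> = 1"
    unfolding Q_mult power_g_eq_1 by simp
  finally show ?thesis
    by simp
qed

text \<open>The squared absolute value is a double sum over \<open>x\<close> and \<open>y\<close>;
  with \<open>x = t * y\<close> it becomes a sum over \<open>t\<close> of the character weighted by
  \<open>overlap t - 1\<close>. The constant part of the weight cancels by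
  \<open>sum_power_ind\<close>, and only \<open>t\<close> in the base field remains.\<close>

theorem Tr_kernel_character_sum:
  fixes z :: complex
  assumes "z ^ Q = 1" "z \<noteq> 1"
  shows "cmod (\<Sum>x | x \<noteq> 0 \<and> Tr x = 0. z ^ ind x) = (real q - 1) * sqrt (real q ^ (n - 2))"
proof -
  let ?H = "{x. x \<noteq> 0 \<and> Tr x = 0}"
  let ?S = "\<Sum>x\<in>?H. z ^ ind x"
  have zN: "z ^ (q ^ n - 1) = 1"
    unfolding Q_mult[symmetric] power_mult using assms(1) by simp
  then have "cmod z ^ (q ^ n - 1) = 1"
    unfolding norm_power[symmetric] by simp
  then have cmod_z: "cmod z = 1"
    using order_pos power_eq_imp_eq_base[of "cmod z" "q ^ n - 1" 1] by simp
  have inner: "(\<Sum>x\<in>?H. z ^ ind x * cnj (z ^ ind y)) =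
      (\<Sum>t\<in>UNIV - {0}. if Tr (t * y) = 0 then z ^ ind t else 0)" if y: "y \<noteq> 0" for y
  proof -
    have unit: "z ^ ind y * cnj (z ^ ind y) = 1"
      using complex_norm_square[of "z ^ ind y"] by (simp add: norm_power cmod_z)
    have "(\<Sum>x\<in>?H. z ^ ind x * cnj (z ^ ind y)) =
        (\<Sum>t | t \<noteq> 0 \<and> Tr (t * y) = 0. z ^ ind (t * y) * cnj (z ^ ind y))"
      by (rule sum.reindex_bij_witness[of _ "\<lambda>t. t * y" "\<lambda>x. x / y"]) (use y in auto)
    also have "\<dots> = (\<Sum>t | t \<noteq> 0 \<and> Tr (t * y) = 0. z ^ ind t)"
      using unit y by (intro sum.cong refl) (simp add: power_ind_mult[OF zN] mult.assoc)
    also have "\<dots> = (\<Sum>t | t \<in> UNIV - {0} \<and> Tr (t * y) = 0. z ^ ind t)"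
      by (intro sum.cong) auto
    also have "\<dots> = (\<Sum>t\<in>UNIV - {0}. if Tr (t * y) = 0 then z ^ ind t else 0)"
      by (rule sum.inter_filter) simp
    finally show ?thesis .
  qed
  have card_t: "(\<Sum>y\<in>?H. if Tr (t * y) = 0 then z ^ ind t else 0) =
      (of_nat (overlap t) - 1) * z ^ ind t" for t
  proof -
    \<comment> \<open>\<open>overlap\<close> counts \<open>y = 0\<close>, which \<open>?H\<close>
      excludes; this is the 1 subtracted.\<close>
    have "{y. Tr y = 0 \<and> Tr (t * y) = 0} = insert 0 {y \<in> ?H. Tr (t * y) = 0}"
      by (auto simp: Tr_0)
    then have "overlap t = Suc (card {y \<in> ?H. Tr (t * y) = 0})"
      by (simp add: overlap_def)
    moreover have "(\<Sum>y\<in>?H. if Tr (t * y) = 0 then z ^ ind t else 0) =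
        (\<Sum>y | y \<in> ?H \<and> Tr (t * y) = 0. z ^ ind t)"
      by (rule sum.inter_filter[symmetric]) simp
    ultimately show ?thesis
      by simp
  qed
  have total: "real (card (base_field - {0})) * (real (q ^ (n - 1)) - real (q ^ (n - 2)))
      = ((real q - 1) * sqrt (real q ^ (n - 2)))\<^sup>2"
  proof -
    define v where "v = real q ^ (n - 2)"
    have v: "real (q ^ (n - 1)) = v * real q" "real (q ^ (n - 2)) = v"
      unfolding q_power_step(2) v_def by simp_all
    have card: "real (card (base_field - {0})) = real q - 1"
      using q_gt_1 by (simp add: card_base_field of_nat_diff)
    have "(sqrt v)\<^sup>2 = v"
      by (simp add: v_def)
    then have sq: "((real q - 1) * sqrt v)\<^sup>2 = (real q - 1)\<^sup>2 * v"
      by (simp only: power_mult_distrib)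
    show ?thesis
      unfolding v card v_def[symmetric] sq by (simp add: power2_eq_square algebra_simps)
  qed
  have "of_real ((cmod ?S)\<^sup>2) = ?S * cnj ?S"
    by (rule complex_norm_square)
  also have "\<dots> = (\<Sum>y\<in>?H. \<Sum>x\<in>?H. z ^ ind x * cnj (z ^ ind y))"
    unfolding cnj_sum sum_product by (rule sum.swap)
  also have "\<dots> = (\<Sum>y\<in>?H. \<Sum>t\<in>UNIV - {0}. if Tr (t * y) = 0 then z ^ ind t else 0)"
    by (intro sum.cong refl inner) simp
  also have "\<dots> = (\<Sum>t\<in>UNIV - {0}. \<Sum>y\<in>?H. if Tr (t * y) = 0 then z ^ ind t else 0)"
    by (rule sum.swap)
  also have "\<dots> = (\<Sum>t\<in>UNIV - {0}. (of_nat (overlap t) - 1) * z ^ ind t)"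
    unfolding card_t ..
  also have "\<dots> = (\<Sum>t\<in>UNIV - {0}. (of_nat (q ^ (n - 2)) - 1) * z ^ ind t
      + (if t \<in> base_field then of_nat (q ^ (n - 1)) - of_nat (q ^ (n - 2)) else 0))"
  proof (intro sum.cong refl)
    fix t :: 'a assume t: "t \<in> UNIV - {0}"
    show "(of_nat (overlap t) - 1) * z ^ ind t = (of_nat (q ^ (n - 2)) - 1) * z ^ ind t
      + (if t \<in> base_field then of_nat (q ^ (n - 1)) - of_nat (q ^ (n - 2)) else 0)"
    proof (cases "t \<in> base_field")
      case True
      then have "Q dvd ind t"
        using t Q_dvd_ind by blast
      then have "z ^ ind t = 1"
        using assms(1) by (auto simp: power_mult elim!: dvdE)
      then show ?thesis
        using True overlap_base_field[OF True] by simp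
    qed (simp add: overlap_outside_base_field)
  qed
  also have "\<dots> = (\<Sum>t\<in>UNIV - {0}. if t \<in> base_field then of_nat (q ^ (n - 1)) - of_nat (q ^ (n - 2)) else 0)"
    unfolding sum.distrib sum_distrib_left[symmetric] sum_power_ind[OF zN assms(2)] by simp
  also have "\<dots> = (\<Sum>t | t \<in> UNIV - {0} \<and> t \<in> base_field. of_nat (q ^ (n - 1)) - of_nat (q ^ (n - 2)))"
    by (rule sum.inter_filter[symmetric]) simp
  also have "\<dots> = (\<Sum>t\<in>base_field - {0}. of_nat (q ^ (n - 1)) - of_nat (q ^ (n - 2)))"
    by (intro sum.cong) auto
  also have "\<dots> = of_real (real (card (base_field - {0})) * (real (q ^ (n - 1)) - real (q ^ (n - 2))))"
    by simp
  finally have "(cmod ?S)\<^sup>2 = ((real q - 1) * sqrt (real q ^ (n - 2)))\<^sup>2"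
    by (simp only: total of_real_eq_iff)
  then show ?thesis
    by (rule power2_eq_imp_eq) (use q_gt_1 in simp_all)
qed

end

section \<open>From a sieved exponent to a primitive element\<close>

lemma coprime_natI:
  fixes a b :: nat
  assumes "\<And>r. prime r \<Longrightarrow> r dvd a \<Longrightarrow> r dvd b \<Longrightarrow> False"
  shows "coprime a b"
proof (rule ccontr)
  assume "\<not> coprime a b"
  then have "gcd a b \<noteq> 1"
    unfolding coprime_iff_gcd_eq_1 .
  then obtain r where r: "prime r" "r dvd gcd a b"
    by (rule prime_factor_nat[THEN exE]) blast
  then show False
    using assms[OF r(1)] by simp
qed

lemma ex_coprime_in_progression:
  fixes a m N :: nat
  assumes "coprime a m" "N > 0"
  shows "\<exists>t. coprime (a + m * t) N"
proof
  \<comment> \<open>With this choice each prime factor of \<open>N\<close> divides exactly one of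
    \<open>a\<close> and \<open>m * ?t\<close>, hence not their sum.\<close>
  let ?t = "\<Prod>r | r \<in> prime_factors N \<and> \<not> r dvd a. r"
  show "coprime (a + m * ?t) N"
  proof (rule coprime_natI)
    fix r assume r: "prime r" "r dvd a + m * ?t" "r dvd N"
    show False
    proof (cases "r dvd a")
      case True
      then have "r dvd m * ?t"
        using r(2) dvd_add_right_iff[OF True] by blast
      moreover have "\<not> r dvd m"
        using coprime_common_divisor[OF assms(1) True] not_prime_unit r(1) by blast
      ultimately have "r dvd ?t"
        using prime_dvd_multD[OF r(1)] by blast
      then obtain r' where "r' \<in> prime_factors N" "\<not> r' dvd a" "r dvd r'"
        using prime_dvd_prod_iff[OF _ r(1), of "{r \<in> prime_factors N. \<not> r dvd a}" "\<lambda>r. r"] by auto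
      then show False
        using primes_dvd_imp_eq[OF r(1)] True in_prime_factors_imp_prime by blast
    next
      case False
      then have "r \<in> {r \<in> prime_factors N. \<not> r dvd a}"
        using r assms(2) by (simp add: prime_factors_dvd)
      then have "r dvd ?t"
        by (rule dvd_prodI[rotated, where f = "\<lambda>r. r"]) simp
      then have "r dvd m * ?t"
        by (rule dvd_mult)
      then have "r dvd a"
        using r(2) dvd_add_left_iff by blast
      then show False
        using False by simp
    qed
  qed
qed

context finite_field_extension
begin

text \<open>If \<open>g ^ c\<close> is a \<open>d\<close>-th power with \<open>d\<close> dividing
  the group order, then comparing exponents modulo \<open>d\<close> shows that \<open>d\<close>
  divides \<open>c\<close>.\<close>

lemma m_free_power_g: "m_free (q ^ n - 1) (g ^ c)" if "coprime c (q ^ n - 1)"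
  unfolding m_free_def
proof (intro conjI allI impI)
  show "g ^ c \<noteq> 0"
    using g_nonzero by simp
next
  fix d \<zeta> assume *: "d dvd q ^ n - 1 \<and> \<zeta> \<noteq> 0 \<and> g ^ c = \<zeta> ^ d"
  then have "g ^ c = g ^ (ind \<zeta> * d)"
    by (simp add: power_mult power_ind)
  then have "[c = ind \<zeta> * d] (mod (q ^ n - 1))"
    by (simp only: power_g_eq_iff)
  then have "[c = ind \<zeta> * d] (mod d)"
    by (rule cong_dvd_modulus_nat) (use * in simp)
  then have "d dvd c"
    using cong_dvd_iff[of c "ind \<zeta> * d" d] by simp
  then have "is_unit d"
    by (rule coprime_common_divisor[OF that]) (use * in simp)
  then show "d = 1"
    by simp
qed

text \<open>\<open>Q\<close> is the geometric sum of \<open>n\<close> powers of \<open>q\<close>, an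
  odd number of odd terms.\<close>

lemma Q_odd: "odd Q" if "odd q" "odd n"
proof -
  have "even (\<Sum>i<m. q ^ i) \<longleftrightarrow> even m" for m
    using that(1) by (induction m) auto
  then have "odd (\<Sum>i<n. q ^ i)"
    using that(2) by simp
  moreover have "int (q ^ n - 1) = int ((\<Sum>i<n. q ^ i) * (q - 1))"
    using q_gt_1 power_diff_1_eq[of "int q" n] by (simp add: of_nat_diff mult.commute)
  then have "Q * (q - 1) = (\<Sum>i<n. q ^ i) * (q - 1)"
    unfolding Q_mult by (simp only: of_nat_eq_iff)
  then have "Q = (\<Sum>i<n. q ^ i)"
    using q_gt_1 by simp
  ultimately show ?thesis
    by simp
qed

text \<open>
  Both conditions on \<open>g ^ a\<close> only depend on \<open>a\<close> modulo \<open>Q\<close>, because \<open>g ^ Q\<close> lies in the base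
  field. Modulo the odd number \<open>Q\<close> the exponent can be halved, and a further shift by a multiple
  of \<open>Q\<close> makes it coprime to the whole group order.
\<close>
lemma primitive_square_root_mod_base_field:
  assumes "odd Q" "coprime a Q" "Tr (g ^ a) = 0"
  obtains c where "coprime c (q ^ n - 1)" "Tr ((g ^ c)\<^sup>2) = 0"
proof -
  \<comment> \<open>Adding the odd number \<open>Q\<close> once repairs the parity of an odd
    \<open>a\<close>.\<close>
  define b where "b = (if even a then 0 else 1 :: nat)"
  have "even (a + Q * b)"
    using assms(1) by (simp add: b_def)
  then obtain h where h: "a + Q * b = 2 * h"
    by blast
  have "coprime h Q"
  proof (rule coprime_natI)
    fix r assume r: "prime r" "r dvd h" "r dvd Q"
    then have "r dvd a + Q * b"
      unfolding h by simp
    moreover have "r dvd Q * b"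
      using r(3) by (rule dvd_mult2)
    ultimately have "r dvd a"
      using dvd_add_left_iff by blast
    then show False
      using coprime_common_divisor[OF assms(2) _ r(3)] not_prime_unit r(1) by blast
  qed
  then obtain t where t: "coprime (h + Q * t) (q ^ n - 1)"
    using ex_coprime_in_progression order_pos by blast
  have "(h + Q * t) * 2 = Q * (b + 2 * t) + a"
    using h by (simp add: algebra_simps)
  then have "(g ^ (h + Q * t))\<^sup>2 = g ^ (Q * (b + 2 * t)) * g ^ a"
    by (simp only: power_mult[symmetric] power_add[symmetric])
  then have "Tr ((g ^ (h + Q * t))\<^sup>2) = 0"
    using Tr_scale[OF power_g_Q_in_base_field] assms(3) by simp
  with t show ?thesis
    by (rule that)
qed

end

section \<open>Application of the sieve to the trace hyperplane\<close>

theorem theorem6p7: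
  fixes q n Q k s :: nat and p :: "nat \<Rightarrow> nat" and \<delta> :: real
  assumes "primepow q" and "q mod 4 = 1"
    and "prime n" and "odd n"
    and "CARD('a :: finite_field) = q ^ n"
    and "Q = (q ^ n - 1) div (q - 1)"
    and "(\<Prod>r\<in>prime_factors Q. r) = k * (\<Prod>i=1..s. p i)"
    and "\<And>i. i \<in> {1..s} \<Longrightarrow> prime (p i) \<and> \<not> p i dvd k"
    and "inj_on p {1..s}"
    and "\<delta> = 1 - (\<Sum>i=1..s. 1 / real (p i))"
    and "\<delta> > 0"
    and "real q powr (real n / 2 - 1) > sqrt 2 * ((real s - 1) / \<delta> + 2) * real (W k)"
  shows "N0 TYPE('a) q n (q ^ n - 1) > 0"
proof -
  obtain g :: 'a where g: "g \<noteq> 0" "\<And>x. x \<noteq> 0 \<Longrightarrow> \<exists>a. x = g ^ a"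
    using finite_field_generator by blast
  have n2: "n \<ge> 2"
    using assms(3) by (rule prime_ge_2_nat)
  interpret F: finite_field_extension q n g
    using assms(1,5) n2 g by unfold_locales
  have Q: "Q = F.Q"
    using assms(6) by (simp add: F.Q_def)
  have odd_q: "odd q"
    using assms(2) by presburger
  have odd_Q: "odd Q"
    using F.Q_odd[OF odd_q assms(4)] Q by simp

  let ?X = "{x. x \<noteq> 0 \<and> F.Tr x = 0}"
  \<comment> \<open>\<open>u\<close> is \<open>q\<close> to the power \<open>n / 2 - 1\<close>, and
    \<open>B\<close> is the exact size of the nontrivial character sums.\<close>
  define u where "u = sqrt (real q ^ (n - 2))"
  define B where "B = (real q - 1) * u"
  have q1: "real q > 1"
    using F.q_gt_1 by simp
  have u1: "u \<ge> 1"
    unfolding u_def using one_le_power[of "real q" "n - 2"] q1 by (intro real_sqrt_ge_one) linarith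
  have uu: "u * u = real q ^ (n - 2)"
    unfolding u_def by (rule real_sqrt_mult_self[THEN trans]) (intro abs_of_nonneg zero_le_power of_nat_0_le_iff)
  have u_powr: "real q powr (real n / 2 - 1) = u"
  proof -
    have "real (n - 2) = real n - 2"
      using n2 by simp
    then have exponent: "real n / 2 - 1 = real (n - 2) * (1 / 2)"
      by linarith
    have "real q powr (real n / 2 - 1) = (real q powr real (n - 2)) powr (1 / 2)"
      unfolding exponent by (rule powr_powr[symmetric])
    moreover have "real q powr real (n - 2) = real q ^ (n - 2)"
      by (rule powr_realpow) (use q1 in linarith)
    moreover have "(real q ^ (n - 2)) powr (1 / 2) = u"
      unfolding u_def by (rule powr_half_sqrt) simp
    ultimately show ?thesis
      by (simp only:)
  qed
  interpret E: bounded_exponential_sums ?X F.ind Q B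
  proof
    show "0 \<le> B"
      using q1 u1 by (simp add: B_def)
    show "cmod (\<Sum>x\<in>?X. z ^ F.ind x) \<le> B" if "z ^ Q = 1" "z \<noteq> 1" for z :: complex
      using F.Tr_kernel_character_sum[OF that[unfolded Q]] by (simp only: B_def u_def order.refl)
  qed simp

  have "{x. F.Tr x = 0} = insert 0 ?X"
    by (auto simp: F.Tr_0)
  then have "Suc (card ?X) = q ^ (n - 1)"
    using F.card_Tr_kernel by simp
  then have card_X: "real (card ?X) = real q * (u * u) - 1"
  proof -
    have "real (Suc (card ?X)) = real (q ^ (n - 2) * q)"
      unfolding F.q_power_step(2)[symmetric] using \<open>Suc (card ?X) = q ^ (n - 1)\<close> by (simp only:)
    then show ?thesis
      unfolding uu by (simp add: algebra_simps)
  qed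

  let ?P = "prime_factors k" and ?P' = "p ` {1..s}"
  \<comment> \<open>Positivity of the product rules out \<open>k = 0\<close>, so
    \<open>prime_factors k\<close> really contains every prime divisor of \<open>k\<close>.\<close>
  have prod_pos: "(\<Prod>r\<in>prime_factors Q. r) > 0"
    by (intro prod_pos) (simp add: in_prime_factors_iff prime_gt_0_nat)
  have k0: "k \<noteq> 0"
    using prod_pos unfolding assms(7) by simp
  have prime_dvd_Q: "r dvd Q" if r: "prime r" "r dvd k * (\<Prod>i=1..s. p i)" for r
  proof -
    have "r dvd (\<Prod>r\<in>prime_factors Q. r)"
      using r(2) by (simp only: assms(7))
    then obtain r' where "r' \<in> prime_factors Q" "r dvd r'"
      using prime_dvd_prod_iff[OF _ r(1), of "prime_factors Q" "\<lambda>r. r"] by auto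
    then show ?thesis
      using dvd_trans[OF _ in_prime_factors_imp_dvd] by blast
  qed
  have primes: "prime r \<and> r dvd Q" if r: "r \<in> ?P \<union> ?P'" for r
  proof (cases "r \<in> ?P")
    case True
    then have "prime r" "r dvd k"
      by (auto dest: in_prime_factors_imp_prime in_prime_factors_imp_dvd)
    then show ?thesis
      using prime_dvd_Q by (simp add: dvd_mult2)
  next
    case False
    then obtain i where i: "i \<in> {1..s}" "r = p i"
      using r by blast
    then have "prime r"
      using assms(8) by blast
    moreover have "r dvd (\<Prod>i=1..s. p i)"
      unfolding i(2) using i(1) by (intro dvd_prodI) auto
    ultimately show ?thesis
      using prime_dvd_Q[OF _ dvd_mult] by blast
  qed
  have disj: "?P \<inter> ?P' = {}"
    using assms(8) by (auto dest: in_prime_factors_imp_dvd)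
  have card_P': "card ?P' = s"
    using assms(9) by (simp add: card_image)
  have \<delta>: "\<delta> = 1 - (\<Sum>r\<in>?P'. 1 / real r)"
    using assms(9,10) by (simp add: sum.reindex)

  define D where "D = ((real s - 1) / \<delta> + 2) * 2 ^ card ?P"
  have "sqrt 2 * D < u"
    using assms(12) u_powr by (simp add: D_def W_def mult.assoc)
  \<comment> \<open>This avoids determining the sign of \<open>D\<close>: a negative
    \<open>D\<close> also lies below \<open>u\<close>, which is at least 1.\<close>
  moreover have "D \<le> sqrt 2 * D \<or> D < 0"
    using mult_right_mono[of 1 "sqrt 2" D] by fastforce
  ultimately have "D < u"
    using u1 by linarith
  then have "B * (D - 1) \<le> B * (u - 1)"
    using E.B_nonneg by (intro mult_left_mono) auto
  also have "B * (u - 1) = real q * (u * u) - u * u - (real q - 1) * u"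
    by (simp add: B_def algebra_simps)
  also have "\<dots> < real q * (u * u) - 1"
  proof -
    have "u * u \<ge> 1"
      using u1 mult_mono[of 1 u 1 u] by simp
    moreover have "(real q - 1) * u > 0"
      using q1 u1 by simp
    ultimately show ?thesis
      by linarith
  qed
  finally have "real (card ?X) > B * (D - 1)"
    by (simp only: card_X)
  then have "E.sieved_count (?P \<union> ?P') > 0"
    using disj primes \<delta> assms(11) card_P' unfolding D_def
    by (intro E.prime_sieve[where \<delta> = \<delta>]) auto
  then have "{x \<in> ?X. \<not> (\<exists>r\<in>?P \<union> ?P'. r dvd F.ind x)} \<noteq> {}"
    unfolding E.sieved_count_def by (metis card.empty less_irrefl)
  then obtain x where x: "x \<noteq> 0" "F.Tr x = 0" "\<And>r. r \<in> ?P \<union> ?P' \<Longrightarrow> \<not> r dvd F.ind x"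
    by blast
  \<comment> \<open>The primes of \<open>k\<close> together with the \<open>p i\<close> are all the
    primes dividing \<open>Q\<close>, and none of them divides the sieved exponent.\<close>
  have "coprime (F.ind x) F.Q"
  proof (rule coprime_natI)
    fix r assume r: "prime r" "r dvd F.ind x" "r dvd F.Q"
    have "Q \<noteq> 0"
      using odd_Q by (intro notI) simp
    then have "r \<in> prime_factors Q"
      using r Q by (simp add: in_prime_factors_iff)
    then have "r dvd k * (\<Prod>i=1..s. p i)"
      unfolding assms(7)[symmetric] by (rule dvd_prodI[rotated, where f = "\<lambda>r. r"]) simp
    then have "r dvd k \<or> (\<exists>i\<in>{1..s}. r dvd p i)"
      using r(1) by (simp add: prime_dvd_mult_iff prime_dvd_prod_iff)
    then have "r \<in> ?P \<union> ?P'"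
    proof
      assume "r dvd k"
      then show ?thesis
        using r(1) k0 by (simp add: in_prime_factors_iff)
    next
      assume "\<exists>i\<in>{1..s}. r dvd p i"
      then show ?thesis
        using assms(8) primes_dvd_imp_eq[OF r(1)] by blast
    qed
    then show False
      using x(3) r(2) by blast
  qed
  moreover have "F.Tr (g ^ F.ind x) = 0"
    using x by (simp add: F.power_ind)
  moreover have "odd F.Q"
    using odd_Q Q by simp
  ultimately obtain c where c: "coprime c (q ^ n - 1)" "F.Tr ((g ^ c)\<^sup>2) = 0"
    using F.primitive_square_root_mod_base_field[of "F.ind x"] by metis
  then have "g ^ c \<in> {\<xi>. m_free (q ^ n - 1) \<xi> \<and> F.Tr (\<xi>\<^sup>2) = 0}"
    using F.m_free_power_g by blast
  then show ?thesis
    unfolding N0_def by (auto simp: card_gt_0_iff)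
qed

end
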